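(* For every positive integer $n$, there exists a spanning subgraph $G$ of the hypercube $Q_n$ with maximum degree at most $120$ such that the diameter of $G$ is $n$.
   Context: $Q_n$ denotes the $n$-dimensional hypercube graph: its vertex set is $\{0,1\}^n$, and two vertices are adjacent if and only if they differ in exactly one coordinate. *)

theory Defs
  imports "Graph_Theory.Graph_Theory"
begin

text \<open>
  Following \<^theory>\<open>Graph_Theory.Digraph\<close>, an undirected simple graph is a finite, loop-free, symmetric
  digraph without parallel arcs (\<^locale>\<open>graph\<close>, or \<^locale>\<open>pair_graph\<close> when arcs are pairs): every
  edge \<open>{u, v}\<close> is the pair of arcs \<open>(u, v)\<close>, \<open>(v, u)\<close>.
\<close>

text \<open>The vertex set \<open>{0, 1}\<^sup>n\<close> is represented by the Boolean lists of length \<open>n\<close>.\<close>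

definition hypercube :: "nat \<Rightarrow> bool list pair_pre_digraph" where
  "hypercube n =
    \<lparr> pverts = {x. length x = n},
      parcs = {(x, y). length x = n \<and> length y = n \<and> (\<exists>!i. i < n \<and> x ! i \<noteq> y ! i)} \<rparr>"

text \<open>
  In a symmetric digraph without parallel arcs the out-degree of a vertex is its number of
  neighbours. Only meaningful for finite graphs with at least one vertex.
\<close>

definition max_degree :: "('a, 'b) pre_digraph \<Rightarrow> nat" where
  "max_degree G = Max (out_degree G ` verts G)"

text \<open>
  With all weights \<open>1\<close>, the cost of a walk is its number of arcs, so this is the least length of a
  walk from \<open>u\<close> to \<open>v\<close>, and \<open>\<infinity>\<close> if there is none.
\<close>

definition graph_dist :: "('a, 'b) pre_digraph \<Rightarrow> 'a \<Rightarrow> 'a \<Rightarrow> ereal" where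
  "graph_dist G u v = wf_digraph.\<mu> G (\<lambda>_. 1) u v"

text \<open>The diameter is \<open>\<infinity>\<close> if the graph is disconnected.\<close>

definition graph_diameter :: "('a, 'b) pre_digraph \<Rightarrow> ereal" where
  "graph_diameter G = (SUP (u, v) \<in> verts G \<times> verts G. graph_dist G u v)"

lemma (in wf_digraph) graph_dist_eq:
  "graph_dist G u v = (INF p \<in> {p. awalk u p v}. ereal (real (length p)))"
  by (simp add: graph_dist_def \<mu>_def awalk_cost_def sum_list_triv)

lemma pair_graph_hypercube: "pair_graph (hypercube n)"
proof
  have fin: "finite {x :: bool list. length x = n}"
    using finite_lists_length_eq[of "UNIV :: bool set" n] by simp
  have sub: "parcs (hypercube n) \<subseteq> {x. length x = n} \<times> {x. length x = n}"
    unfolding hypercube_def by clarsimp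
  show "finite (pverts (hypercube n))"
    using fin by (simp add: hypercube_def)
  show "finite (parcs (hypercube n))"
    using sub by (rule finite_subset) (intro finite_cartesian_product fin)
  show "symmetric (with_proj (hypercube n))"
    unfolding symmetric_def with_proj_simps
  proof (rule symI)
    fix x y assume "(x, y) \<in> parcs (hypercube n)"
    moreover have "(x ! i \<noteq> y ! i) = (y ! i \<noteq> x ! i)" for i by (rule neq_commute)
    ultimately show "(y, x) \<in> parcs (hypercube n)"
      by (simp only: hypercube_def pair_pre_digraph.simps mem_Collect_eq case_prod_conv)
  qed
  fix e assume e: "e \<in> parcs (hypercube n)"
  with sub have "e \<in> {x. length x = n} \<times> {x. length x = n}" by (rule subsetD)
  then show "fst e \<in> pverts (hypercube n)" "snd e \<in> pverts (hypercube n)"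
    by (simp_all add: hypercube_def mem_Times_iff)
  from e show "fst e \<noteq> snd e"
    by (cases e) (clarsimp simp: hypercube_def)
qed

end

theory Submission
  imports Defs "HOL-Library.Z2" "HOL-Library.Function_Algebras"
begin

text \<open>
  Put \<open>N = 2\<^sup>K\<close> and split the \<open>n\<close> coordinates evenly into blocks, one for each direction
  \<open>1 \<le> i < N\<close>, each with at least 4 and at most 12 elements. Label a vertex \<open>x\<close> of the hypercube by the
  syndrome in \<open>{0..<N}\<close> that adds up, bitwise modulo 2, the Gray code \<open>gray i\<close> of the direction of each
  coordinate set in \<open>x\<close>. A coordinate of direction \<open>i\<close> may be flipped at \<open>x\<close> only if the label of \<open>x\<close>
  is an end of one of two edges, both of colour \<open>gray i\<close>, of a fixed skeleton graph on \<open>{0..<N}\<close>: the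
  edges at \<open>i\<close> and at \<open>i + 1\<close>. At most 6 directions are available at each label, which bounds the
  degree by 72. (For \<open>n < 4\<close> blocks of size 4 are impossible; there \<open>K = 1\<close> gives the whole
  hypercube.)

  Over the field with two elements the skeleton edges span all edges of the complete graph on
  \<open>{0..<N}\<close>. Hence for every set of directions there is a set \<open>F\<close> of skeleton edges using exactly these
  directions an odd number of times and having at most two odd vertices, one of them prescribed if
  there are any. Taking the edges of \<open>F\<close> once and all others twice gives a connected multigraph, and
  its Euler trail uses every direction between 1 and 4 times with the prescribed parity. Lifted to
  the hypercube, the trail visits every block and makes at most as many flips in it as the block has
  coordinates: superfluous traversals flip a coordinate back and forth, and missing flips are added
  while the block is available.
\<close>

unbundle bit_operations_syntax

section \<open>Binary addition and the Gray code\<close>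

text \<open>The reflected Gray code. The edge of colour \<open>gray i\<close> at the vertex
  \<open>i\<close> leads to \<open>i div 2\<close>, so over all \<open>i \<ge> 1\<close> these edges
  form a binary tree with root 0.\<close>

definition gray :: "nat \<Rightarrow> nat" where
  "gray i = i XOR (i div 2)"

lemma xor_less_power2: "a XOR b < 2 ^ k" if "a < 2 ^ k" "b < 2 ^ k" for a b :: nat
  using that by (metis take_bit_nat_eq_self_iff take_bit_xor)

lemma xor_upper_half:
  fixes a b :: nat
  assumes "2 ^ k \<le> a" "a < 2 ^ Suc k" "b < 2 ^ k"
  shows "2 ^ k \<le> a XOR b" "a XOR b < 2 ^ Suc k"
proof -
  show "a XOR b < 2 ^ Suc k"
    using assms by (intro xor_less_power2) auto
  show "2 ^ k \<le> a XOR b"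
  proof (rule ccontr)
    assume "\<not> 2 ^ k \<le> a XOR b"
    then have "(a XOR b) XOR b < 2 ^ k"
      using assms by (intro xor_less_power2[of "a XOR b"]) auto
    then show False
      using assms by (simp add: xor.assoc)
  qed
qed

lemma xor_both_upper_half:
  fixes a b :: nat
  assumes "2 ^ k \<le> a" "a < 2 ^ Suc k" "2 ^ k \<le> b" "b < 2 ^ Suc k"
  shows "a XOR b < 2 ^ k"
proof -
  have "a div 2 ^ k = 1" "b div 2 ^ k = 1"
    using assms by (auto intro!: div_nat_eqI)
  then have "(a XOR b) div 2 ^ k = 0"
    by (simp flip: drop_bit_eq_div)
  then show ?thesis
    by (simp add: div_eq_0_iff)
qed

lemma xor_left_self [simp]: "a XOR (a XOR b) = b" for a b :: nat
  by (simp flip: xor.assoc)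

lemma xor_right_self [simp]: "(a XOR b) XOR b = a" for a b :: nat
  by (simp add: xor.assoc)

lemma xor_eq_0_iff_nat [simp]: "a XOR b = 0 \<longleftrightarrow> a = b" for a b :: nat
  by (metis xor_left_self xor_self_eq xor.right_neutral)

lemma xor_right_cancel [simp]: "a XOR c = b XOR c \<longleftrightarrow> a = b" for a b c :: nat
  by (metis xor_right_self)

lemma xor_left_cancel [simp]: "c XOR a = c XOR b \<longleftrightarrow> a = b" for a b c :: nat
  by (metis xor_left_self)

lemma div2_upper_half: "v div 2 < 2 ^ k" if "v < 2 ^ Suc k" for v :: nat
  using that by auto

lemma gray_upper_half:
  assumes "2 ^ k \<le> i" "i < 2 ^ Suc k"
  shows "2 ^ k \<le> gray i" "gray i < 2 ^ Suc k"
  unfolding gray_def using xor_upper_half[OF assms div2_upper_half] assms by auto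

text \<open>Halving commutes with \<open>gray\<close>, so by induction \<open>gray x\<close>
  determines \<open>x div 2\<close>, and then \<open>x\<close> is
  \<open>gray x XOR (x div 2)\<close>.\<close>

lemma inj_gray: "inj gray"
proof (rule injI)
  fix x y
  show "gray x = gray y \<Longrightarrow> x = y"
  proof (induction x arbitrary: y rule: less_induct)
    case (less x)
    show ?case
    proof (cases "x = 0")
      case True
      then have "y XOR (y div 2) = 0"
        using less.prems by (simp add: gray_def)
      then have "y = y div 2"
        by simp
      then show ?thesis
        using True by simp
    next
      case False
      have "gray (z div 2) = gray z div 2" for z
        by (simp add: gray_def xor_nat_rec[of z])
      then have "x div 2 = y div 2"
        using less False by simp
      then show ?thesis
        using less.prems by (simp add: gray_def)
    qed
  qed
qed

lemma gray_eq_iff [simp]: "gray i = gray j \<longleftrightarrow> i = j"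
  using inj_gray by (simp add: inj_eq)

lemma gray_surj_upper_half:
  assumes "2 ^ k \<le> a" "a < 2 ^ Suc k"
  shows "\<exists>i. 2 ^ k \<le> i \<and> i < 2 ^ Suc k \<and> gray i = a"
proof -
  let ?U = "{2 ^ k..<2 ^ Suc k}"
  have "gray ` ?U = ?U"
    using gray_upper_half by (intro endo_inj_surj) (auto intro!: inj_onI)
  then have "a \<in> gray ` ?U"
    using assms by simp
  then show ?thesis by auto
qed

lemma gray_0_iff [simp]: "gray i = 0 \<longleftrightarrow> i = 0"
  using gray_eq_iff[of i 0] by (simp add: gray_def del: gray_eq_iff)

lemma xor_gray: "i XOR gray i = i div 2"
  by (simp add: gray_def)

text \<open>
  Think of \<open>S\<close> as the span, over the field with two elements, of the edges with ends
  \<open>i\<close> and \<open>i XOR gray i\<close>, or \<open>i + 1\<close> and \<open>(i + 1) XOR gray i\<close>. An edge with ends \<open>a\<close>, \<open>b\<close>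
  contributes its two ends and its colour \<open>a XOR b\<close>. The claim is that these few edges span all
  edges of the complete graph.
\<close>

lemma gray_edges_span:
  fixes f c :: "nat \<Rightarrow> 'm::ab_group_add" and S :: "'m set"
  assumes two: "\<And>x::'m. x + x = 0" and zero: "0 \<in> S" and c0: "c 0 = 0"
    and add: "\<And>x y. x \<in> S \<Longrightarrow> y \<in> S \<Longrightarrow> x + y \<in> S"
    and tree: "\<And>i. 1 \<le> i \<Longrightarrow> i < 2 ^ K \<Longrightarrow> f i + f (i XOR gray i) + c (gray i) \<in> S"
    and shifted: "\<And>i. 1 \<le> i \<Longrightarrow> i + 1 < 2 ^ K \<Longrightarrow>
      f (i + 1) + f ((i + 1) XOR gray i) + c (gray i) \<in> S"
    and ab: "a < 2 ^ K" "b < 2 ^ K"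
  shows "f a + f b + c (a XOR b) \<in> S"
proof -
  have two' [simp]: "x + (x + y) = y" for x y :: 'm
    using two[of x] by (simp flip: add.assoc)
  note two [simp] zero [simp]
  have [simp]: "- x = x" for x :: 'm
    using two[of x] by (simp add: eq_neg_iff_add_eq_0 neg_eq_iff_add_eq_0)
  define w where "w a b = f a + f b + c (a XOR b)" for a b
  have w_commute: "w a b = w b a" for a b
    by (simp add: w_def ac_simps)
  \<comment> \<open>The induction doubles the vertex set: \<open>w a b\<close> is the vector of the
    edge from \<open>a\<close> to \<open>b\<close>, and the complete graph on the lower half is
    already spanned.\<close>
  have "\<forall>a<2 ^ k. \<forall>b<2 ^ k. w a b \<in> S" if "k \<le> K" for k
    using that
  proof (induction k)
    case 0
    show ?case
      by (simp add: w_def c0)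
  next
    case (Suc k)
    then have IH: "w a b \<in> S" if "a < 2 ^ k" "b < 2 ^ k" for a b
      using that by auto
    have "(2::nat) ^ Suc k \<le> 2 ^ K"
      using Suc.prems by (intro power_increasing) auto
    then have below: "v < 2 ^ K" if "v < 2 ^ Suc k" for v :: nat
      using that by auto
    have pos: "(1::nat) \<le> 2 ^ k"
      by simp
    \<comment> \<open>The triangle on 0, \<open>p\<close> and \<open>p XOR q\<close>: its vertices
      cancel and its three colours remain.\<close>
    have c_lin: "c p + c q + c (p XOR q) \<in> S" if "p < 2 ^ k" "q < 2 ^ k" for p q
    proof -
      have "w 0 p + w 0 (p XOR q) + w p (p XOR q) \<in> S"
        using that by (intro add IH xor_less_power2) auto
      then show ?thesis
        by (simp add: w_def ac_simps)
    qed
    \<comment> \<open>The two edges of colour \<open>gray v\<close> lead from \<open>v\<close> and \<open>v + 1\<close> to the lower half, where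
      everything is spanned already; in their sum the colour cancels.\<close>
    have w_step: "w v (v + 1) \<in> S" if v: "2 ^ k \<le> v" "v + 1 < 2 ^ Suc k" for v
    proof -
      let ?x = "v XOR gray v" and ?y = "(v + 1) XOR gray v"
      have x: "?x < 2 ^ k"
        using v by (auto simp: xor_gray)
      have y: "?y < 2 ^ k"
        using v gray_upper_half[of k v] by (intro xor_both_upper_half) auto
      have "1 \<le> v" "v + 1 < 2 ^ K"
        using pos v(1) below[OF v(2)] by linarith+
      then have "w v ?x \<in> S" "w (v + 1) ?y \<in> S"
        using tree[of v] shifted[of v] by (simp_all add: w_def)
      then have "w v ?x + w (v + 1) ?y + w ?x ?y \<in> S"
        using x y by (intro add IH[of ?x ?y])
      moreover have "?x XOR ?y = v XOR (v + 1)"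
        by (simp add: ac_simps)
      ultimately show ?thesis
        by (simp add: w_def ac_simps)
    qed
    \<comment> \<open>The edges from \<open>v\<close> to \<open>v + 1\<close> are chained;
      \<open>c_lin\<close> merges two colours of the lower half into the colour of their
      sum.\<close>
    have w_base: "w (2 ^ k) v \<in> S" if "2 ^ k \<le> v" "v < 2 ^ Suc k" for v
      using that
    proof (induction v rule: dec_induct)
      case base
      show ?case
        by (simp add: w_def c0)
    next
      case (step v)
      let ?p = "2 ^ k XOR v" and ?q = "v XOR (v + 1)"
      have "?p < 2 ^ k" "?q < 2 ^ k"
        using step by (auto intro!: xor_both_upper_half)
      then have "w (2 ^ k) v + w v (v + 1) + (c ?p + c ?q + c (?p XOR ?q)) \<in> S"
        using step by (intro add w_step c_lin) auto
      then show ?case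
        by (simp add: w_def ac_simps)
    qed
    have w_upper: "w v v' \<in> S"
      if v: "2 ^ k \<le> v" "v < 2 ^ Suc k" "2 ^ k \<le> v'" "v' < 2 ^ Suc k" for v v'
    proof -
      let ?p = "2 ^ k XOR v" and ?q = "2 ^ k XOR v'"
      have "?p < 2 ^ k" "?q < 2 ^ k"
        using v by (auto intro!: xor_both_upper_half)
      then have "w (2 ^ k) v + w (2 ^ k) v' + (c ?p + c ?q + c (?p XOR ?q)) \<in> S"
        using v by (intro add w_base c_lin) auto
      then show ?thesis
        by (simp add: w_def ac_simps)
    qed
    \<comment> \<open>Some tree edge, from \<open>i\<close> in the upper to \<open>j\<close> in the
      lower half, has the colour of the wanted edge. The edges from \<open>i\<close> to
      \<open>v\<close> and from \<open>j\<close> to \<open>x\<close> then have equal colours, which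
      cancel.\<close>
    have w_cross: "w v x \<in> S" if v: "2 ^ k \<le> v" "v < 2 ^ Suc k" "x < 2 ^ k" for v x
    proof -
      obtain i where i: "2 ^ k \<le> i" "i < 2 ^ Suc k" "gray i = v XOR x"
        using gray_surj_upper_half xor_upper_half v by meson
      define j where "j = i XOR gray i"
      have j: "j < 2 ^ k"
        unfolding j_def xor_gray using i by auto
      have x: "x = v XOR (i XOR j)" "gray i = i XOR j"
        using i(3) by (simp_all add: j_def)
      have "w i j \<in> S"
        using tree[of i] below[of i] i pos by (simp add: w_def j_def)
      then have "w i j + w i v + w j x \<in> S"
        using i v j by (intro add IH[of j x] w_upper[of i v])
      moreover have "j XOR x = i XOR v" "v XOR x = i XOR j"
        unfolding x(1) by (simp_all add: ac_simps)
      ultimately show ?thesis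
        by (simp add: w_def ac_simps)
    qed
    show ?case
      using IH w_upper w_cross w_commute by (metis not_le_imp_less)
  qed
  then show ?thesis
    using ab by (auto simp: w_def)
qed

section \<open>Euler trails in the skeleton\<close>

text \<open>An edge \<open>e\<close> joins \<open>src e\<close> and \<open>src e XOR col e\<close>, so traversing it in either direction adds \<open>col e\<close>.\<close>

primrec walk :: "('e \<Rightarrow> nat) \<Rightarrow> ('e \<Rightarrow> nat) \<Rightarrow> nat \<Rightarrow> 'e list \<Rightarrow> nat \<Rightarrow> bool" where
  "walk src col v [] v' \<longleftrightarrow> v = v'"
| "walk src col v (e # es) v' \<longleftrightarrow>
    (v = src e \<or> v = src e XOR col e) \<and> walk src col (v XOR col e) es v'"

lemma walk_append:
  "walk src col u (xs @ ys) w \<longleftrightarrow> (\<exists>v. walk src col u xs v \<and> walk src col v ys w)"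
  by (induction xs arbitrary: u) auto

lemma walk_map:
  "walk src col u (map g es) w \<longleftrightarrow> walk (src \<circ> g) (col \<circ> g) u es w"
  by (induction es arbitrary: u) auto

text \<open>Values are taken modulo 2, so that sums of \<open>inc\<close> are parities of degrees;
  the two ends of a loop cancel.\<close>

definition inc :: "('e \<Rightarrow> nat) \<Rightarrow> ('e \<Rightarrow> nat) \<Rightarrow> 'e \<Rightarrow> nat \<Rightarrow> bit" where
  "inc src col e v = of_bool (v = src e) + of_bool (v = src e XOR col e)"

lemma bit_add_self_left [simp]: "x + (x + y) = y" for x y :: bit
  by (cases x; cases y) simp_all

lemma bit_telescope: "(x + y) + (y + z) = x + z" for x y z :: bit
  by (cases x; cases y; cases z) simp_all

lemma bit_cancel_left: "x + y = (x + z) + d \<Longrightarrow> d = z + y" for x y z d :: bit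
  by (cases x; cases y; cases z; cases d) simp_all

lemma bit_sum_eq_0D: "(x + y) + d = 0 \<Longrightarrow> d = y + x" for x y d :: bit
  by (cases x; cases y; cases d) simp_all

lemma inc_eq:
  assumes "u = src e \<or> u = src e XOR col e"
  shows "inc src col e v = of_bool (v = u) + of_bool (v = u XOR col e)"
  using assms by (auto simp: inc_def)

lemma sum_inc_walk:
  assumes "walk src col u es w" "distinct es"
  shows "(\<Sum>e\<in>set es. inc src col e v) = of_bool (v = u) + of_bool (v = w)"
  using assms
proof (induction es arbitrary: u)
  case (Cons e es)
  have "(\<Sum>e\<in>set (e # es). inc src col e v) = inc src col e v + (\<Sum>e\<in>set es. inc src col e v)"
    using Cons.prems by simp
  also have "inc src col e v = of_bool (v = u) + of_bool (v = u XOR col e)"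
    using Cons.prems by (intro inc_eq) simp
  also have "(\<Sum>e\<in>set es. inc src col e v) = of_bool (v = u XOR col e) + of_bool (v = w)"
    using Cons.prems by (intro Cons.IH) auto
  finally show ?case
    by (simp only: bit_telescope)
qed simp

text \<open>If \<open>s \<noteq> t\<close>, the degree of \<open>s\<close> is odd, so some edge
  starts at \<open>s\<close>. Deleting it moves the odd vertex to its other end, from which the
  induction continues the trail.\<close>

lemma trail_exists:
  assumes "finite E"
    and "\<And>v. (\<Sum>e\<in>E. inc src col e v) = of_bool (v = s) + of_bool (v = t)"
  shows "\<exists>es. distinct es \<and> set es \<subseteq> E \<and> walk src col s es t"
  using assms
proof (induction E arbitrary: s rule: finite_psubset_induct)
  case (psubset E)
  show ?case
  proof (cases "s = t")
    case True
    then show ?thesis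
      by (intro exI[of _ "[]"]) simp
  next
    case False
    have "\<exists>e\<in>E. inc src col e s \<noteq> 0"
    proof (rule ccontr)
      assume "\<not> (\<exists>e\<in>E. inc src col e s \<noteq> 0)"
      then have "(\<Sum>e\<in>E. inc src col e s) = 0"
        by (intro sum.neutral) blast
      then show False
        using psubset.prems[of s] False by simp
    qed
    then obtain e where e: "e \<in> E" "s = src e \<or> s = src e XOR col e"
      by (auto simp: inc_def split: if_splits)
    have inc_e: "inc src col e v = of_bool (v = s) + of_bool (v = s XOR col e)" for v
      using e(2) by (rule inc_eq)
    have "(\<Sum>e\<in>E - {e}. inc src col e v) = of_bool (v = s XOR col e) + of_bool (v = t)" for v
    proof -
      have "(\<Sum>e\<in>E. inc src col e v) = inc src col e v + (\<Sum>e\<in>E - {e}. inc src col e v)"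
        using psubset.hyps e by (intro sum.remove) auto
      then have "of_bool (v = s) + of_bool (v = t) = of_bool (v = s) + of_bool (v = s XOR col e)
          + (\<Sum>e\<in>E - {e}. inc src col e v)"
        by (simp only: psubset.prems inc_e)
      then show ?thesis
        by (rule bit_cancel_left)
    qed
    then obtain es where "distinct es" "set es \<subseteq> E - {e}" "walk src col (s XOR col e) es t"
      using psubset.IH[of "E - {e}"] e by blast
    then show ?thesis
      using e by (intro exI[of _ "e # es"]) auto
  qed
qed

lemma euler_trail_exists:
  assumes fin: "finite E"
    and par: "\<And>v. (\<Sum>e\<in>E. inc src col e v) = of_bool (v = s) + of_bool (v = t)"
    and conn: "\<And>V. s \<in> V \<Longrightarrow> (\<And>e. e \<in> E \<Longrightarrow> src e \<in> V \<longleftrightarrow> src e XOR col e \<in> V) \<Longrightarrow>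
      src ` E \<subseteq> V"
  shows "\<exists>es. distinct es \<and> set es = E \<and> walk src col s es t"
proof -
  define trail where "trail es \<longleftrightarrow> distinct es \<and> set es \<subseteq> E \<and> walk src col s es t" for es
  obtain es0 where es0: "trail es0"
    using trail_exists[OF fin par] unfolding trail_def by blast
  have "length es < Suc (card E)" if "trail es" for es
    using that distinct_card[of es] card_mono[OF fin, of "set es"] by (simp add: trail_def)
  then obtain es where es: "trail es" and max: "\<And>es'. trail es' \<Longrightarrow> length es' \<le> length es"
    using es0 ex_has_greatest_nat[of trail es0 length "Suc (card E)"] by blast
  \<comment> \<open>The vertices visited by \<open>es\<close>, each with a place to insert a
    detour.\<close>
  define V where "V = {w. \<exists>xs ys. es = xs @ ys \<and> walk src col s xs w \<and> walk src col w ys t}"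
  have dist: "distinct es" and sub: "set es \<subseteq> E" and walk: "walk src col s es t"
    using es by (auto simp: trail_def)
  have used: "w \<in> V \<and> w XOR col e \<in> V"
    if e: "e \<in> set es" and w: "w = src e \<or> w = src e XOR col e" for e w
  proof -
    obtain xs ys where split: "es = xs @ e # ys"
      using split_list[OF e] by blast
    then obtain u where u: "walk src col s xs u" "u = src e \<or> u = src e XOR col e"
      "walk src col (u XOR col e) ys t"
      using walk by (auto simp: walk_append)
    have "u \<in> V"
      unfolding V_def using split u by (intro CollectI exI[of _ xs] exI[of _ "e # ys"]) simp
    moreover have "u XOR col e \<in> V"
      unfolding V_def using split u
      by (intro CollectI exI[of _ "xs @ [e]"] exI[of _ ys]) (auto simp: walk_append)
    ultimately show ?thesis
      using u(2) w by auto
  qed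
  have closed: "e \<in> set es" if e: "e \<in> E" and w: "w \<in> V" "w = src e \<or> w = src e XOR col e" for e w
  proof (rule ccontr)
    assume unused: "e \<notin> set es"
    obtain xs ys where split: "es = xs @ ys" "walk src col s xs w" "walk src col w ys t"
      using w by (auto simp: V_def)
    let ?E = "E - set es - {e}"
    \<comment> \<open>Outside the trail all degrees are even, so without \<open>e\<close> only the
      ends of \<open>e\<close> can be odd, and \<open>trail_exists\<close> closes the
      detour.\<close>
    have "(\<Sum>e\<in>?E. inc src col e v) = of_bool (v = w XOR col e) + of_bool (v = w)" for v
    proof -
      have "(\<Sum>e\<in>E. inc src col e v) = (\<Sum>e\<in>E - set es. inc src col e v) + (\<Sum>e\<in>set es. inc src col e v)"
        using fin sub by (rule sum.subset_diff[rotated])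
      also have "(\<Sum>e\<in>E - set es. inc src col e v) = inc src col e v + (\<Sum>e\<in>?E. inc src col e v)"
        using fin e unused by (intro sum.remove) auto
      finally have "inc src col e v + (\<Sum>e\<in>?E. inc src col e v) = 0"
        unfolding sum_inc_walk[OF walk dist] par by (metis add_cancel_left_left)
      then show ?thesis
        unfolding inc_eq[of w src e col v, OF w(2)] by (rule bit_sum_eq_0D)
    qed
    then obtain zs where zs: "distinct zs" "set zs \<subseteq> ?E" "walk src col (w XOR col e) zs w"
      using trail_exists[of ?E] fin by blast
    have "trail (xs @ e # zs @ ys)"
      using zs split e unused dist sub w(2) by (auto simp: trail_def walk_append)
    from max[OF this] show False
      using split(1) by simp
  qed
  have "src ` E \<subseteq> V"
  proof (rule conn)
    show "s \<in> V"
      unfolding V_def using walk by (intro CollectI exI[of _ "[]"] exI[of _ es]) simp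
    show "src e \<in> V \<longleftrightarrow> src e XOR col e \<in> V" if "e \<in> E" for e
      using closed[OF that] used[of e "src e"] by blast
  qed
  then have "E \<subseteq> set es"
    using closed by blast
  then show ?thesis
    using dist sub walk by blast
qed

section \<open>The skeleton: prescribed parities by linear algebra\<close>

text \<open>
  The pair \<open>(b, i)\<close> stands for the edge of direction \<open>i\<close> and colour \<open>gray i\<close> at the vertex \<open>i\<close>
  or, if \<open>b\<close> is true, at the vertex \<open>i + 1\<close>.
\<close>

definition base :: "bool \<times> nat \<Rightarrow> nat" where
  "base e = snd e + of_bool (fst e)"

definition skeleton :: "nat \<Rightarrow> (bool \<times> nat) set" where
  "skeleton K = {e. 1 \<le> snd e \<and> base e < 2 ^ K}"

lemma finite_skeleton: "finite (skeleton K)"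
  by (rule finite_subset[of _ "UNIV \<times> {..<2 ^ K}"]) (auto simp: skeleton_def base_def)

lemma of_nat_bit: "of_nat n = (of_bool (odd n) :: bit)"
  by (induction n) auto

text \<open>Common terms cancel in characteristic two. This makes the sums over subsets of a finite
  set closed under addition.\<close>

lemma sum_symmetric_difference:
  fixes g :: "'e \<Rightarrow> 'm::ab_group_add"
  assumes two: "\<And>x::'m. x + x = 0" and fin: "finite A" "finite B"
  shows "sum g A + sum g B = sum g (A - B \<union> (B - A))"
proof -
  have "sum g A = sum g (A - B) + sum g (A \<inter> B)" "sum g B = sum g (B - A) + sum g (A \<inter> B)"
    using sum.Int_Diff[OF fin(1), of g B] sum.Int_Diff[OF fin(2), of g A]
    by (simp_all add: ac_simps Int_commute)
  then have "sum g A + sum g B = sum g (A - B) + sum g (B - A) + (sum g (A \<inter> B) + sum g (A \<inter> B))"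
    by (simp add: ac_simps)
  moreover have "sum g (A - B \<union> (B - A)) = sum g (A - B) + sum g (B - A)"
    using fin by (intro sum.union_disjoint) auto
  ultimately show ?thesis
    using two by simp
qed

lemma fun_bit_add_self [simp]: "x + x = 0" for x :: "'a \<Rightarrow> bit"
  by (simp add: fun_eq_iff)

lemma sum_fun_apply: "(\<Sum>i\<in>A. g i) x = (\<Sum>i\<in>A. g i x)" for g :: "'i \<Rightarrow> 'a \<Rightarrow> bit"
  by (induction A rule: infinite_finite_induct) auto

text \<open>The complete graph has a walk from \<open>s\<close> using each colour
  \<open>gray i\<close>, \<open>i \<in> R\<close>, once; \<open>t\<close> is its end. By
  \<open>gray_edges_span\<close> its vector lies in the span of the skeleton edges, hence is the sum
  over some set \<open>F\<close>.\<close>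

lemma skeleton_parity:
  assumes s: "s < 2 ^ K" and R: "R \<subseteq> {1..<2 ^ K}"
  shows "\<exists>t F. F \<subseteq> skeleton K \<and>
    (\<forall>v. (\<Sum>e\<in>F. inc base (gray \<circ> snd) e v) = of_bool (v = s) + of_bool (v = t)) \<and>
    (\<forall>i\<ge>1. (\<Sum>e\<in>F. of_bool (snd e = i) :: bit) = of_bool (i \<in> R))"
proof -
  \<comment> \<open>A coordinate \<open>Inl v\<close> for each vertex and \<open>Inr a\<close> for
    each colour lets one equation record both kinds of parity. \<open>c 0\<close> must vanish for
    \<open>gray_edges_span\<close>.\<close>
  define f :: "nat \<Rightarrow> nat + nat \<Rightarrow> bit" where "f v = (\<lambda>x. of_bool (x = Inl v))" for v
  define c :: "nat \<Rightarrow> nat + nat \<Rightarrow> bit" where "c a = (\<lambda>x. of_bool (a \<noteq> 0 \<and> x = Inr a))" for a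
  define g where "g e = f (base e) + f (base e XOR gray (snd e)) + c (gray (snd e))" for e
  define S where "S = sum g ` Pow (skeleton K)"
  have fin: "finite F" if "F \<subseteq> skeleton K" for F
    using finite_subset[OF that finite_skeleton] .
  have zero: "0 \<in> S"
    unfolding S_def by (rule image_eqI[of _ _ "{}"]) auto
  have add: "x + y \<in> S" if xy: "x \<in> S" "y \<in> S" for x y
  proof -
    obtain A B where "A \<subseteq> skeleton K" "B \<subseteq> skeleton K" "x = sum g A" "y = sum g B"
      using xy by (auto simp: S_def)
    then show ?thesis
      unfolding S_def using fin
      by (intro image_eqI[of _ _ "A - B \<union> (B - A)"]) (auto simp: sum_symmetric_difference)
  qed
  have c0: "c 0 = 0"
    by (simp add: c_def fun_eq_iff)
  have edge: "g e \<in> S" if "e \<in> skeleton K" for e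
    unfolding S_def using that by (intro image_eqI[of _ _ "{e}"]) auto
  have span: "f a + f b + c (a XOR b) \<in> S" if "a < 2 ^ K" "b < 2 ^ K" for a b
  proof (rule gray_edges_span[where f = f and c = c and S = S, OF fun_bit_add_self zero c0 add _ _ that])
    show "f i + f (i XOR gray i) + c (gray i) \<in> S" if "1 \<le> i" "i < 2 ^ K" for i
      using edge[of "(False, i)"] that by (simp add: g_def skeleton_def base_def)
    show "f (i + 1) + f ((i + 1) XOR gray i) + c (gray i) \<in> S" if "1 \<le> i" "i + 1 < 2 ^ K" for i
      using edge[of "(True, i)"] that by (simp add: g_def skeleton_def base_def)
  qed
  have "finite R"
    using R finite_subset by blast
  then have "\<exists>t<2 ^ K. f s + f t + (\<Sum>i\<in>R. c (gray i)) \<in> S"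
    using R
  proof (induction R rule: finite_induct)
    case empty
    then show ?case
      using s zero by (intro exI[of _ s]) (simp add: zero_fun_def)
  next
    case (insert i R)
    then obtain t where t: "t < 2 ^ K" "f s + f t + (\<Sum>i\<in>R. c (gray i)) \<in> S"
      using insert.IH insert.prems by blast
    have "gray i < 2 ^ K"
      using insert.prems unfolding gray_def by (intro xor_less_power2) auto
    then have u: "t XOR gray i < 2 ^ K"
      using t xor_less_power2 by blast
    have "f s + f t + (\<Sum>i\<in>R. c (gray i)) + (f t + f (t XOR gray i) + c (t XOR (t XOR gray i))) \<in> S"
      by (rule add[OF t(2) span[OF t(1) u]])
    moreover have "f t + (f t + x) = x" for x
      by (simp flip: add.assoc)
    ultimately have "f s + f (t XOR gray i) + (\<Sum>i\<in>insert i R. c (gray i)) \<in> S"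
      by (simp only: sum.insert[OF insert.hyps] xor_left_self ac_simps)
    then show ?case
      using u by blast
  qed
  then obtain t F where F: "F \<subseteq> skeleton K" and eq: "sum g F = f s + f t + (\<Sum>i\<in>R. c (gray i))"
    unfolding S_def image_iff by (metis PowD)
  have finR: "finite R" by fact
  show ?thesis
  proof (intro exI conjI allI impI)
    show "F \<subseteq> skeleton K" by fact
    show "(\<Sum>e\<in>F. inc base (gray \<circ> snd) e v) = of_bool (v = s) + of_bool (v = t)" for v
    proof -
      have "sum g F (Inl v) = (\<Sum>e\<in>F. inc base (gray \<circ> snd) e v)"
        by (simp add: sum_fun_apply g_def f_def c_def inc_def)
      moreover have "(f s + f t + (\<Sum>i\<in>R. c (gray i))) (Inl v) = of_bool (v = s) + of_bool (v = t)"
        by (simp add: sum_fun_apply f_def c_def)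
      ultimately show ?thesis
        using eq by simp
    qed
    \<comment> \<open>The coordinate \<open>Inr (gray i)\<close>; since \<open>i \<ge> 1\<close>,
      this colour is nonzero and survives in \<open>c\<close>.\<close>
    show "(\<Sum>e\<in>F. of_bool (snd e = i) :: bit) = of_bool (i \<in> R)" 
      if i: "1 \<le> i" for i
    proof -
      have "sum g F (Inr (gray i)) = (\<Sum>e\<in>F. of_bool (snd e = i))"
        using i by (auto simp: sum_fun_apply g_def f_def c_def intro!: sum.cong)
      moreover have "(f s + f t + (\<Sum>i\<in>R. c (gray i))) (Inr (gray i)) = (\<Sum>j\<in>R. of_bool (gray j \<noteq> 0 \<and> gray i = gray j))"
        by (simp add: sum_fun_apply f_def c_def del: gray_eq_iff gray_0_iff)
      moreover have "\<dots> = (\<Sum>j\<in>R. of_bool (j = i))"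
        using i by (intro sum.cong) auto
      moreover have "(\<Sum>j\<in>R. of_bool (j = i) :: bit) = of_bool (i \<in> R)"
        using finR by (simp add: of_bool_def sum.delta)
      ultimately show ?thesis
        using eq by simp
    qed
  qed
qed

lemma sum_fst_times_singleton: "(\<Sum>e\<in>A \<times> {b}. h (fst e)) = (\<Sum>e\<in>A. h e)"
  by (rule sum.reindex_bij_witness[of _ "\<lambda>e. (e, b)" fst]) auto

text \<open>An Euler trail realizes the parities of \<open>skeleton_parity\<close>. Its counts are
  at most 4 because a direction has at most two edges, each with at most two copies.\<close>

lemma skeleton_walk:
  assumes s: "s < 2 ^ K" and R: "R \<subseteq> {1..<2 ^ K}"
  shows "\<exists>es t. walk base (gray \<circ> snd) s es t \<and> set es \<subseteq> skeleton K \<and>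
    (\<forall>i\<in>{1..<2 ^ K}. 1 \<le> count_list (map snd es) i \<and> count_list (map snd es) i \<le> 4 \<and>
      (odd (count_list (map snd es) i) \<longleftrightarrow> i \<in> R))"
proof -
  obtain t F where F: "F \<subseteq> skeleton K"
    and par: "\<And>v. (\<Sum>e\<in>F. inc base (gray \<circ> snd) e v) = of_bool (v = s) + of_bool (v = t)"
    and col: "\<And>i. 1 \<le> i \<Longrightarrow> (\<Sum>e\<in>F. of_bool (snd e = i) :: bit) = of_bool (i \<in> R)"
    using skeleton_parity[OF s R] by blast
  \<comment> \<open>Taking the edges outside \<open>F\<close> twice keeps all parities and makes the multigraph connected.\<close>
  define E where "E = skeleton K \<times> {False} \<union> (skeleton K - F) \<times> {True}"
  have finE: "finite E"
    by (simp add: E_def finite_skeleton)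
  have sumE: "(\<Sum>e\<in>E. h (fst e)) = (\<Sum>e\<in>F. h e)" for h :: "bool \<times> nat \<Rightarrow> bit"
  proof -
    have "(\<Sum>e\<in>E. h (fst e)) = (\<Sum>e\<in>skeleton K \<times> {False}. h (fst e)) +
        (\<Sum>e\<in>(skeleton K - F) \<times> {True}. h (fst e))"
      unfolding E_def by (intro sum.union_disjoint) (auto simp: finite_skeleton)
    also have "\<dots> = (\<Sum>e\<in>skeleton K. h e) + (\<Sum>e\<in>skeleton K - F. h e)"
      by (simp only: sum_fst_times_singleton)
    also have "\<dots> = (\<Sum>e\<in>F. h e)"
      unfolding sum.subset_diff[OF F finite_skeleton] by (metis add.commute bit_add_self_left)
    finally show ?thesis .
  qed
  have "\<exists>es. distinct es \<and> set es = E \<and> walk (base \<circ> fst) (gray \<circ> snd \<circ> fst) s es t"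
  proof (rule euler_trail_exists)
    show "finite E" by fact
    show "(\<Sum>e\<in>E. inc (base \<circ> fst) (gray \<circ> snd \<circ> fst) e v) = of_bool (v = s) + of_bool (v = t)" for v
      using sumE[of "\<lambda>e. inc base (gray \<circ> snd) e v"] par[of v] by (simp only: inc_def o_apply)
    fix V
    assume sV: "s \<in> V"
      and closed: "\<And>e. e \<in> E \<Longrightarrow>
        (base \<circ> fst) e \<in> V \<longleftrightarrow> (base \<circ> fst) e XOR (gray \<circ> snd \<circ> fst) e \<in> V"
    \<comment> \<open>The edges \<open>(False, i)\<close> form the tree that links every vertex to
      0.\<close>
    have parent: "i \<in> V \<longleftrightarrow> i div 2 \<in> V" if "1 \<le> i" "i < 2 ^ K" for i
      using closed[of "((False, i), False)"] that by (simp add: E_def skeleton_def base_def xor_gray)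
    have root: "v \<in> V \<longleftrightarrow> 0 \<in> V" if "v < 2 ^ K" for v
      using that
    proof (induction v rule: less_induct)
      case (less v)
      show ?case
      proof (cases "v = 0")
        case False
        then have "v \<in> V \<longleftrightarrow> v div 2 \<in> V"
          using less.prems by (intro parent) auto
        also have "\<dots> \<longleftrightarrow> 0 \<in> V"
          using False less.prems by (intro less.IH) auto
        finally show ?thesis .
      next
        case True
        then show ?thesis
          by (simp only:)
      qed
    qed
    have "0 \<in> V"
      using sV root[OF s] by blast
    show "(base \<circ> fst) ` E \<subseteq> V"
    proof
      fix v
      assume "v \<in> (base \<circ> fst) ` E"
      then have "v < 2 ^ K"
        by (auto simp: E_def skeleton_def)
      then show "v \<in> V"
        using root \<open>0 \<in> V\<close> by blast
    qed
  qed
  then obtain es where es: "distinct es" "set es = E"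
    and walk: "walk (base \<circ> fst) (gray \<circ> snd \<circ> fst) s es t"
    by blast
  have count: "count_list (map snd (map fst es)) i = card {e \<in> E. snd (fst e) = i}" for i
    using es by (simp add: count_list_eq_length_filter filter_map distinct_length_filter o_def
        Int_def eq_commute conj_commute)
  show ?thesis
  proof (intro exI conjI ballI)
    show "walk base (gray \<circ> snd) s (map fst es) t"
      using walk by (simp add: walk_map o_assoc)
    show "set (map fst es) \<subseteq> skeleton K"
      unfolding set_map es(2) by (auto simp: E_def)
    fix i :: nat
    assume i: "i \<in> {1..<2 ^ K}"
    let ?C = "{e \<in> E. snd (fst e) = i}"
    have "{((False, i), False)} \<subseteq> ?C"
      using i by (auto simp: E_def skeleton_def base_def)
    then have "1 \<le> card ?C"
      using card_mono[of ?C "{((False, i), False)}"] finE by simp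
    then show "1 \<le> count_list (map snd (map fst es)) i"
      unfolding count .
    have "card ?C \<le> card (((UNIV :: bool set) \<times> {i}) \<times> (UNIV :: bool set))"
      by (rule card_mono) auto
    then show "count_list (map snd (map fst es)) i \<le> 4"
      unfolding count by (simp add: card_cartesian_product)
    have "of_nat (card ?C) = (\<Sum>e\<in>E. of_bool (snd (fst e) = i) :: bit)"
      using finE by (simp add: Collect_conj_eq)
    also have "\<dots> = of_bool (i \<in> R)"
      unfolding sumE[of "\<lambda>e. of_bool (snd e = i)"] using i by (intro col) simp
    finally show "odd (count_list (map snd (map fst es)) i) \<longleftrightarrow> i \<in> R"
      unfolding count of_nat_bit of_bool_eq_iff .
  qed
qed

section \<open>Availability of directions\<close>

definition shifted :: "nat \<Rightarrow> nat" where
  "shifted i = (i + 1) XOR gray i"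

lemma shifted_even: "shifted (2 * a) = 1 XOR a"
proof -
  have "(2 * a + 1) XOR (2 * a) = 1"
    unfolding xor_nat_rec[of "2 * a + 1" "2 * a"] by simp
  then show ?thesis
    by (simp add: shifted_def gray_def flip: xor.assoc)
qed

lemma shifted_odd: "shifted (2 * a + 1) = 2 * shifted a + of_bool (even a)"
proof -
  have "(2 * a + 1) XOR a = of_bool (even a) + 2 * (a XOR (a div 2))"
    unfolding xor_nat_rec[of "2 * a + 1" a] by simp
  then have "(2 * a + 2) XOR ((2 * a + 1) XOR a) =
      of_bool (even a) + 2 * ((a + 1) XOR (a XOR (a div 2)))"
    by (simp only: xor_nat_rec[of "2 * a + 2" "of_bool (even a) + 2 * (a XOR (a div 2))"]) simp
  then show ?thesis
    by (simp add: shifted_def gray_def)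
qed

text \<open>For even numbers \<open>shifted_even\<close> is an explicit injection. At
  \<open>2 * a + 1\<close> the last bit of the value gives the parity of \<open>a\<close> and the
  other bits give \<open>shifted a\<close>, so the claim descends to \<open>a\<close>.\<close>

lemma shifted_inj_parity:
  "shifted i = shifted j \<Longrightarrow> even i \<longleftrightarrow> even j \<Longrightarrow> i = j"
proof (induction i arbitrary: j rule: less_induct)
  case (less i)
  show ?case
  proof (cases "even i")
    case True
    then obtain a b where "i = 2 * a" "j = 2 * b"
      using less.prems by (auto elim!: evenE)
    then show ?thesis
      using less.prems by (simp add: shifted_even)
  next
    case False
    then obtain a b where ab: "i = 2 * a + 1" "j = 2 * b + 1"
      using less.prems by (auto elim!: oddE)
    then have eq: "2 * shifted a + of_bool (even a) = 2 * shifted b + of_bool (even b)"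
      using less.prems(1) by (simp only: shifted_odd)
    then have "even a \<longleftrightarrow> even b"
      by (metis even_add even_mult_iff even_numeral odd_of_bool_self)
    moreover from this have "shifted a = shifted b"
      using eq by auto
    ultimately have "a = b"
      using less.IH[of a b] ab by simp
    then show ?thesis
      using ab by simp
  qed
qed

definition avail :: "nat \<Rightarrow> nat \<Rightarrow> bool" where
  "avail s i \<longleftrightarrow> (\<exists>b. s = base (b, i) \<or> s = base (b, i) XOR gray i)"

text \<open>Adding the colour swaps the ends of an edge; this makes \<open>sparse_cube\<close>
  symmetric.\<close>

lemma avail_xor: "avail (s XOR gray i) i \<longleftrightarrow> avail s i"
  unfolding avail_def by (metis xor_right_self)

lemma avail_cases:
  "avail s i \<longleftrightarrow> s = i \<or> s = i div 2 \<or> s = i + 1 \<or> s = shifted i"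
  by (auto simp: avail_def base_def ex_bool_eq xor_gray shifted_def)

text \<open>The four cases of \<open>avail_cases\<close> allow \<open>s\<close>, then
  \<open>2 * s\<close> and \<open>2 * s + 1\<close>, then \<open>s - 1\<close>, and at most one
  \<open>i\<close> of each parity with \<open>shifted i = s\<close>.\<close>

lemma avail_card: "finite {i. avail s i}" "card {i. avail s i} \<le> 6"
proof -
  obtain p where p: "\<And>i. even i \<Longrightarrow> shifted i = s \<Longrightarrow> i = p"
    using shifted_inj_parity by metis
  obtain q where q: "\<And>i. odd i \<Longrightarrow> shifted i = s \<Longrightarrow> i = q"
    using shifted_inj_parity by metis
  have sub: "{i. avail s i} \<subseteq> set [s, 2 * s, 2 * s + 1, s - 1, p, q]"
    using p q by (auto simp: avail_cases)
  then show "finite {i. avail s i}"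
    by (rule finite_subset) simp
  have "card {i. avail s i} \<le> card (set [s, 2 * s, 2 * s + 1, s - 1, p, q])"
    using sub by (intro card_mono) auto
  also have "\<dots> \<le> 6"
    using card_length[of "[s, 2 * s, 2 * s + 1, s - 1, p, q]"] by simp
  finally show "card {i. avail s i} \<le> 6" .
qed

section \<open>The sparse subgraph of the hypercube\<close>

text \<open>As for a linear code, with \<open>g l\<close> as the column of the parity-check matrix
  at coordinate \<open>l\<close>.\<close>

primrec syndrome :: "(nat \<Rightarrow> nat) \<Rightarrow> bool list \<Rightarrow> nat \<Rightarrow> nat" where
  "syndrome g x 0 = 0"
| "syndrome g x (Suc k) = syndrome g x k XOR (if x ! k then g k else 0)"

definition flip :: "bool list \<Rightarrow> nat \<Rightarrow> bool list" where
  "flip x l = x[l := \<not> x ! l]"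

lemma length_flip [simp]: "length (flip x l) = length x"
  by (simp add: flip_def)

lemma nth_flip: "l < length x \<Longrightarrow> flip x l ! j = (if j = l then \<not> x ! l else x ! j)"
  by (simp add: flip_def nth_list_update)

lemma flip_flip [simp]: "flip (flip x l) l = x"
  by (cases "l < length x") (simp_all add: flip_def list_update_beyond)

lemma syndrome_flip:
  assumes "k \<le> length x" "l < length x"
  shows "syndrome g (flip x l) k = syndrome g x k XOR (if l < k then g l else 0)"
  using assms
proof (induction k)
  case (Suc k)
  then show ?case
    by (auto simp: nth_flip ac_simps less_Suc_eq)
qed simp

lemma syndrome_less:
  assumes "\<And>l. g l < 2 ^ K"
  shows "syndrome g x k < 2 ^ K"
  using assms by (induction k) (auto intro!: xor_less_power2)

text \<open>Cyclic distribution keeps the blocks even; the offset avoids direction 0, whose colour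
  is 0.\<close>

definition direction :: "nat \<Rightarrow> nat \<Rightarrow> nat" where
  "direction K l = 1 + l mod (2 ^ K - 1)"

definition label :: "nat \<Rightarrow> bool list \<Rightarrow> nat" where
  "label K x = syndrome (\<lambda>l. gray (direction K l)) x (length x)"

definition sparse_cube :: "nat \<Rightarrow> nat \<Rightarrow> bool list pair_pre_digraph" where
  "sparse_cube K n =
    \<lparr> pverts = {x. length x = n},
      parcs = {(x, flip x l) | x l. length x = n \<and> l < n \<and> avail (label K x) (direction K l)} \<rparr>"

lemma gray_less_power2: "i < 2 ^ K \<Longrightarrow> gray i < 2 ^ K"
  unfolding gray_def by (intro xor_less_power2) auto

lemma direction_range:
  assumes "K \<ge> 1"
  shows "direction K l \<in> {1..<2 ^ K}"
proof -
  have "(2::nat) ^ 1 \<le> 2 ^ K"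
    using assms by (intro power_increasing) auto
  then have "l mod (2 ^ K - 1) < 2 ^ K - 1"
    by (intro mod_less_divisor) simp
  then show ?thesis
    by (auto simp: direction_def)
qed

lemma label_less: "K \<ge> 1 \<Longrightarrow> label K x < 2 ^ K"
  unfolding label_def using direction_range by (intro syndrome_less gray_less_power2) auto

lemma label_flip: "l < length x \<Longrightarrow> label K (flip x l) = label K x XOR gray (direction K l)"
  by (simp add: label_def syndrome_flip)

lemma flip_in_hypercube: "l < length x \<Longrightarrow> (x, flip x l) \<in> parcs (hypercube (length x))"
  by (auto simp: hypercube_def nth_flip intro!: ex1I[of _ l])

section \<open>Lifting label walks to the cube\<close>

definition mismatch :: "nat \<Rightarrow> bool list \<Rightarrow> bool list \<Rightarrow> nat \<Rightarrow> nat set" where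
  "mismatch K x y i = {l. l < length x \<and> direction K l = i \<and> x ! l \<noteq> y ! l}"

lemma finite_mismatch [simp]: "finite (mismatch K x y i)"
  by (simp add: mismatch_def)

lemma mismatch_flip:
  assumes "l < length x"
  shows "mismatch K (flip x l) y i =
    (if direction K l = i
     then (if x ! l = y ! l then insert l (mismatch K x y i) else mismatch K x y i - {l})
     else mismatch K x y i)"
  using assms by (auto simp: mismatch_def nth_flip split: if_splits)

text \<open>The label follows \<open>es\<close> while coordinates of the current direction are
  flipped. With \<open>c\<close> traversals and \<open>d\<close> mismatches left in that direction,
  every flip lowers \<open>max c d\<close>, so the sum bounds the length. The invariants, equal
  parity and \<open>d = 0\<close> whenever \<open>c = 0\<close>, force \<open>x = y\<close> when
  \<open>es\<close> is exhausted.\<close>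

lemma sparse_cube_walk:
  assumes K: "K \<ge> 1"
    and "length x = n" "length y = n" "walk base (gray \<circ> snd) (label K x) es t"
    and "\<And>i. i \<in> snd ` set es \<Longrightarrow> i \<in> {1..<2 ^ K} \<and> (\<exists>l<n. direction K l = i)"
    and "\<And>i. i \<in> {1..<2 ^ K} \<Longrightarrow> even (count_list (map snd es) i + card (mismatch K x y i)) \<and>
      (count_list (map snd es) i = 0 \<longrightarrow> mismatch K x y i = {})"
  shows "\<exists>p. pre_digraph.awalk (with_proj (sparse_cube K n)) x p y \<and>
    length p \<le> (\<Sum>i\<in>{1..<2 ^ K}. max (count_list (map snd es) i) (card (mismatch K x y i)))"
  using assms(2-)
proof (induction "\<Sum>i\<in>{1..<2 ^ K}. max (count_list (map snd es) i) (card (mismatch K x y i))"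
    arbitrary: x es rule: less_induct)
  case less
  note awalk_def = pre_digraph.awalk_def
  show ?case
  proof (cases es)
    case Nil
    have "x ! l = y ! l" if "l < n" for l
    proof -
      have "mismatch K x y (direction K l) = {}"
        using less.prems(5)[OF direction_range[OF K]] Nil by simp
      then show ?thesis
        using that less.prems(1) by (auto simp: mismatch_def)
    qed
    then have "x = y"
      using less.prems(1,2) by (intro nth_equalityI) auto
    then have "pre_digraph.awalk (with_proj (sparse_cube K n)) x [] y"
      using less.prems(1) by (simp add: awalk_def sparse_cube_def pre_digraph.cas.simps)
    then show ?thesis
      by (metis le0 list.size(3))
  next
    case (Cons e es0)
    define i where "i = snd e"
    define c where "c j = count_list (map snd es) j" for j
    define d where "d j = card (mismatch K x y j)" for j
    have i: "i \<in> {1..<2 ^ K}" "\<exists>l<n. direction K l = i"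
      using less.prems(4)[of i] Cons by (auto simp: i_def)
    have c_pos: "c i \<ge> 1"
      using Cons by (simp add: c_def i_def)
    have par: "even (c j + d j)" if "j \<in> {1..<2 ^ K}" for j
      using less.prems(5)[OF that] by (simp add: c_def d_def)
    have no_edge: "mismatch K x y j = {}" if "j \<in> {1..<2 ^ K}" "c j = 0" for j
      using less.prems(5)[OF that(1)] that(2) by (simp add: c_def)
    have e: "label K x = base e \<or> label K x = base e XOR gray i"
      and es0: "walk base (gray \<circ> snd) (label K x XOR gray i) es0 t"
      using less.prems(3) Cons by (auto simp: i_def)
    have av: "avail (label K x) i"
      unfolding avail_def using e by (metis i_def surjective_pairing)
    \<comment> \<open>The part shared by all cases: one flip in direction \<open>i\<close> leaves
      the other directions unchanged, so only the invariants and the measure at \<open>i\<close>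
      remain to be checked.\<close>
    have step: ?thesis
      if l: "l < n" "direction K l = i"
        and es': "walk base (gray \<circ> snd) (label K x XOR gray i) es' t" "set es' \<subseteq> set es"
        and c': "\<And>j. j \<noteq> i \<Longrightarrow> count_list (map snd es') j = c j"
        and par': "even (count_list (map snd es') i + card (mismatch K (flip x l) y i))"
        and no': "count_list (map snd es') i = 0 \<Longrightarrow> mismatch K (flip x l) y i = {}"
        and dec: "max (count_list (map snd es') i) (card (mismatch K (flip x l) y i)) < max (c i) (d i)"
      for l es'
    proof -
      have d': "mismatch K (flip x l) y j = mismatch K x y j" if "j \<noteq> i" for j
        using l that less.prems(1) by (simp add: mismatch_flip)
      let ?M = "\<Sum>i\<in>{1..<2 ^ K}. max (count_list (map snd es) i) (card (mismatch K x y i))"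
      let ?M' = "\<Sum>i\<in>{1..<2 ^ K}. max (count_list (map snd es') i) (card (mismatch K (flip x l) y i))"
      have M: "?M' < ?M"
      proof (rule sum_strict_mono_ex1)
        show "\<forall>j\<in>{1..<2 ^ K}. max (count_list (map snd es') j) (card (mismatch K (flip x l) y j))
            \<le> max (count_list (map snd es) j) (card (mismatch K x y j))"
        proof
          fix j
          show "max (count_list (map snd es') j) (card (mismatch K (flip x l) y j))
            \<le> max (count_list (map snd es) j) (card (mismatch K x y j))"
            using dec c'[of j] d'[of j] by (cases "j = i") (auto simp: c_def d_def)
        qed
        show "\<exists>j\<in>{1..<2 ^ K}. max (count_list (map snd es') j) (card (mismatch K (flip x l) y j))
            < max (count_list (map snd es) j) (card (mismatch K x y j))"
          using dec i(1) by (intro bexI[of _ i]) (auto simp: c_def d_def)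
      qed simp
      have "\<exists>p. pre_digraph.awalk (with_proj (sparse_cube K n)) (flip x l) p y \<and> length p \<le> ?M'"
      proof (rule less.hyps[OF M])
        show "length (flip x l) = n" "length y = n"
          using less.prems by simp_all
        show "walk base (gray \<circ> snd) (label K (flip x l)) es' t"
          using es' l less.prems(1) by (simp add: label_flip)
        show "j \<in> {1..<2 ^ K} \<and> (\<exists>l<n. direction K l = j)" if "j \<in> snd ` set es'" for j
          using less.prems(4)[of j] es'(2) that by blast
        show "even (count_list (map snd es') j + card (mismatch K (flip x l) y j)) \<and>
          (count_list (map snd es') j = 0 \<longrightarrow> mismatch K (flip x l) y j = {})"
          if "j \<in> {1..<2 ^ K}" for j
        proof (cases "j = i")
          case True
          then show ?thesis
            using par' no' by blast
        next
          case False
          then show ?thesis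
            using c'[OF False] d'[OF False] par[OF that] no_edge[OF that] by (simp add: d_def)
        qed
      qed
      then obtain p where p: "pre_digraph.awalk (with_proj (sparse_cube K n)) (flip x l) p y"
        "length p \<le> ?M'"
        by blast
      have "(x, flip x l) \<in> parcs (sparse_cube K n)"
        using l av less.prems(1) by (auto simp: sparse_cube_def)
      then have "pre_digraph.awalk (with_proj (sparse_cube K n)) x ((x, flip x l) # p) y"
        using p less.prems(1) by (auto simp: awalk_def pre_digraph.cas.simps sparse_cube_def)
      moreover have "length ((x, flip x l) # p) \<le> ?M"
        using p(2) M by simp
      ultimately show ?thesis
        by blast
    qed
    consider (long) "d i > c i" | (short) "0 < d i" "d i \<le> c i" | (none) "d i = 0"
      by linarith
    then show ?thesis
    proof cases
      \<comment> \<open>Too few traversals are left: fix a coordinate and go back and forth on \<open>e\<close> once more.\<close>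
      case long
      then have "mismatch K x y i \<noteq> {}"
        by (auto simp: d_def)
      then obtain l where l: "l \<in> mismatch K x y i"
        by blast
      then have l': "l < n" "direction K l = i" "x ! l \<noteq> y ! l"
        using less.prems(1) by (auto simp: mismatch_def)
      then have d': "card (mismatch K (flip x l) y i) = d i - 1"
        using l less.prems(1) by (simp add: mismatch_flip d_def)
      have c': "count_list (map snd (e # es)) i = Suc (c i)"
        by (simp add: c_def i_def)
      show ?thesis
      proof (rule step[OF l'(1,2)])
        show "walk base (gray \<circ> snd) (label K x XOR gray i) (e # es) t"
          using e less.prems(3) by (auto simp: i_def)
        show "set (e # es) \<subseteq> set es"
          using Cons by simp
        show "count_list (map snd (e # es)) j = c j" if "j \<noteq> i" for j
          using that by (simp add: c_def i_def)
        show "even (count_list (map snd (e # es)) i + card (mismatch K (flip x l) y i))"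
          unfolding c' d' using par[OF i(1)] long by auto
        show "mismatch K (flip x l) y i = {}" if "count_list (map snd (e # es)) i = 0"
          using that unfolding c' by simp
        \<comment> \<open>Parity excludes the one case in which the maximum would not drop.\<close>
        have "d i \<noteq> Suc (c i)"
          using par[OF i(1)] by auto
        then show "max (count_list (map snd (e # es)) i) (card (mismatch K (flip x l) y i)) < max (c i) (d i)"
          unfolding c' d' using long by linarith
      qed
    next
      \<comment> \<open>Enough traversals are left: this one fixes a coordinate.\<close>
      case short
      then have "mismatch K x y i \<noteq> {}"
        by (auto simp: d_def)
      then obtain l where l: "l \<in> mismatch K x y i"
        by blast
      then have l': "l < n" "direction K l = i" "x ! l \<noteq> y ! l"
        using less.prems(1) by (auto simp: mismatch_def)
      then have d': "card (mismatch K (flip x l) y i) = d i - 1"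
        using l less.prems(1) by (simp add: mismatch_flip d_def)
      have c': "count_list (map snd es0) i = c i - 1"
        using Cons by (simp add: c_def i_def)
      show ?thesis
      proof (rule step[OF l'(1,2) es0])
        show "set es0 \<subseteq> set es"
          using Cons by auto
        show "count_list (map snd es0) j = c j" if "j \<noteq> i" for j
          using that Cons by (simp add: c_def i_def)
        show "even (count_list (map snd es0) i + card (mismatch K (flip x l) y i))"
          unfolding c' d' using par[OF i(1)] short c_pos by (cases "c i"; cases "d i") auto
        show "mismatch K (flip x l) y i = {}" if "count_list (map snd es0) i = 0"
        proof -
          have "card (mismatch K (flip x l) y i) = 0"
            unfolding d' using short that[unfolded c'] by linarith
          then show ?thesis
            by simp
        qed
        show "max (count_list (map snd es0) i) (card (mismatch K (flip x l) y i)) < max (c i) (d i)"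
          unfolding c' d' using short by linarith
      qed
    next
      \<comment> \<open>Nothing is left to fix, so this traversal spoils a coordinate. By parity
        \<open>c i \<ge> 2\<close>, so a later one can repair it.\<close>
      case none
      obtain l where l: "l < n" "direction K l = i"
        using i by blast
      have mm: "mismatch K x y i = {}"
        using none by (simp add: d_def)
      then have "x ! l = y ! l"
        using l less.prems(1) by (auto simp: mismatch_def)
      then have d': "mismatch K (flip x l) y i = {l}"
        using l less.prems(1) mm by (simp add: mismatch_flip)
      have c': "count_list (map snd es0) i = c i - 1"
        using Cons by (simp add: c_def i_def)
      have "c i \<noteq> 1"
        using par[OF i(1)] none by auto
      then have c2: "c i \<ge> 2"
        using c_pos by linarith
      show ?thesis
      proof (rule step[OF l es0])
        show "set es0 \<subseteq> set es"
          using Cons by auto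
        show "count_list (map snd es0) j = c j" if "j \<noteq> i" for j
          using that Cons by (simp add: c_def i_def)
        show "even (count_list (map snd es0) i + card (mismatch K (flip x l) y i))"
          unfolding c' d' using par[OF i(1)] none c_pos by (cases "c i") auto
        show "mismatch K (flip x l) y i = {}" if "count_list (map snd es0) i = 0"
          using that c2 unfolding c' by linarith
        show "max (count_list (map snd es0) i) (card (mismatch K (flip x l) y i)) < max (c i) (d i)"
          unfolding c' d' using c2 by simp
      qed
    qed
  qed
qed

section \<open>Block sizes and walks of length at most \<open>n\<close>\<close>

definition block :: "nat \<Rightarrow> nat \<Rightarrow> nat \<Rightarrow> nat set" where
  "block K n i = {l. l < n \<and> direction K l = i}"

lemma finite_block [simp]: "finite (block K n i)"
  by (simp add: block_def)

lemma card_block_le: "card (block K n i) \<le> n div (2 ^ K - 1) + 1"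
proof -
  let ?m = "2 ^ K - 1 :: nat"
  have "l \<in> (\<lambda>q. q * ?m + (i - 1)) ` {..n div ?m}" if "l \<in> block K n i" for l
  proof
    have "l < n" "l mod ?m = i - 1"
      using that by (auto simp: block_def direction_def)
    then show "l = l div ?m * ?m + (i - 1)" "l div ?m \<in> {..n div ?m}"
      using div_mult_mod_eq[of l ?m] by (auto intro: div_le_mono)
  qed
  then have "card (block K n i) \<le> card ((\<lambda>q. q * ?m + (i - 1)) ` {..n div ?m})"
    by (intro card_mono) auto
  also have "\<dots> \<le> card {..n div ?m}"
    by (rule card_image_le) simp
  finally show ?thesis
    by simp
qed

lemma card_block_ge:
  assumes "i \<in> {1..<2 ^ K}"
  shows "n div (2 ^ K - 1) \<le> card (block K n i)"
proof -
  let ?m = "2 ^ K - 1 :: nat"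
  have i: "i - 1 < ?m"
    using assms by auto
  have "inj_on (\<lambda>q. q * ?m + (i - 1)) {..<n div ?m}"
    using i by (auto simp: inj_on_def)
  then have "n div ?m = card ((\<lambda>q. q * ?m + (i - 1)) ` {..<n div ?m})"
    by (simp add: card_image)
  also have "\<dots> \<le> card (block K n i)"
  proof (rule card_mono)
    show "(\<lambda>q. q * ?m + (i - 1)) ` {..<n div ?m} \<subseteq> block K n i"
    proof safe
      fix q assume "q < n div ?m"
      then have "Suc q * ?m \<le> n div ?m * ?m"
        by (intro mult_le_mono1) simp
      also have "\<dots> \<le> n"
        by simp
      finally have "q * ?m + (i - 1) < n"
        using i by simp
      moreover have "direction K (q * ?m + (i - 1)) = i"
        unfolding direction_def mod_mult_self3 using i assms by (simp only: mod_less) simp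
      ultimately show "q * ?m + (i - 1) \<in> block K n i"
        by (simp add: block_def)
    qed
  qed simp
  finally show ?thesis .
qed

lemma sum_card_block:
  assumes "K \<ge> 1"
  shows "(\<Sum>i\<in>{1..<2 ^ K}. card (block K n i)) = n"
proof -
  have "(\<Sum>i\<in>{1..<2 ^ K}. \<Sum>l\<in>{l \<in> {..<n}. direction K l = i}. 1) = (\<Sum>l<n. 1 :: nat)"
    using direction_range[OF assms] by (intro sum.group) auto
  then show ?thesis
    by (simp add: block_def)
qed

lemma card_mismatch_le: "length x = n \<Longrightarrow> card (mismatch K x y i) \<le> card (block K n i)"
  by (intro card_mono) (auto simp: mismatch_def block_def)

text \<open>The edge \<open>(False, 1)\<close> joins 0 and 1, so it can be crossed back and forth
  arbitrarily often; this serves the case \<open>K = 1\<close>.\<close>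

lemma parity_walk:
  assumes "v < 2"
  shows "\<exists>t. walk base (gray \<circ> snd) v (replicate w (False, 1)) t"
  using assms
proof (induction w arbitrary: v)
  case (Suc w)
  have "v XOR 1 < 2" "v = 1 \<or> v = 1 XOR 1"
    using Suc.prems by (auto simp: less_2_cases_iff)
  then show ?case
    using Suc.IH[of "v XOR 1"] by (simp add: base_def gray_def)
qed auto

text \<open>In each direction both traversals and mismatches number at most the size of the block,
  so the bound of \<open>sparse_cube_walk\<close> is at most the sum of the block sizes, which is
  \<open>n\<close>.\<close>

lemma sparse_cube_geodesics:
  assumes K: "K \<ge> 1" and n: "n \<ge> 1" and size: "4 * (2 ^ K - 1) \<le> n \<or> K = 1"
    and x: "length x = n" and y: "length y = n"
  shows "\<exists>p. pre_digraph.awalk (with_proj (sparse_cube K n)) x p y \<and> length p \<le> n"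
proof -
  have onto: "\<exists>l<n. direction K l = i" if "i \<in> {1..<2 ^ K}" for i
  proof (intro exI conjI)
    show "i - 1 < n"
      using that size n by auto
    show "direction K (i - 1) = i"
      using that by (auto simp: direction_def)
  qed
  have "\<exists>es t. walk base (gray \<circ> snd) (label K x) es t \<and> snd ` set es \<subseteq> {1..<2 ^ K} \<and>
    (\<forall>i\<in>{1..<2 ^ K}. even (count_list (map snd es) i + card (mismatch K x y i)) \<and>
      (count_list (map snd es) i = 0 \<longrightarrow> mismatch K x y i = {}) \<and>
      count_list (map snd es) i \<le> card (block K n i))"
    using size
  proof
    assume size: "4 * (2 ^ K - 1) \<le> n"
    have "(2::nat) ^ 1 \<le> 2 ^ K"
      using K by (intro power_increasing) auto
    then have "4 \<le> n div (2 ^ K - 1)"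
      using size by (simp add: less_eq_div_iff_mult_less_eq)
    then have four: "4 \<le> card (block K n i)" if "i \<in> {1..<2 ^ K}" for i
      using card_block_ge[OF that, of n] by linarith
    let ?R = "{i \<in> {1..<2 ^ K}. odd (card (mismatch K x y i))}"
    have R: "?R \<subseteq> {1..<2 ^ K}"
      by (rule Collect_restrict)
    obtain es t where walk: "walk base (gray \<circ> snd) (label K x) es t" and es: "set es \<subseteq> skeleton K"
      and count: "\<forall>i\<in>{1..<2 ^ K}. 1 \<le> count_list (map snd es) i \<and> count_list (map snd es) i \<le> 4 \<and>
        (odd (count_list (map snd es) i) \<longleftrightarrow> i \<in> ?R)"
      using skeleton_walk[OF label_less[OF K] R, of x] by (elim exE conjE)
    have "snd ` set es \<subseteq> {1..<2 ^ K}"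
      using es by (auto simp: skeleton_def base_def)
    moreover have "even (count_list (map snd es) i + card (mismatch K x y i)) \<and>
      (count_list (map snd es) i = 0 \<longrightarrow> mismatch K x y i = {}) \<and>
      count_list (map snd es) i \<le> card (block K n i)" if "i \<in> {1..<2 ^ K}" for i
      using bspec[OF count that] four[OF that] that by auto
    ultimately show ?thesis
      using walk by (intro exI[of _ es] exI[of _ t] conjI[OF walk] conjI ballI) simp_all
  next
    assume K1: "K = 1"
    \<comment> \<open>The only block may have fewer than 4 coordinates, so the edge is crossed
      exactly once per mismatch.\<close>
    let ?w = "card (mismatch K x y 1)"
    have I: "{1..<2 ^ K} = {1 :: nat}"
      unfolding K1 by auto
    have "label K x < 2"
      using label_less[OF K, of x] K1 by simp
    then obtain t where t: "walk base (gray \<circ> snd) (label K x) (replicate ?w (False, 1)) t"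
      using parity_walk by blast
    have "count_list (replicate w (Suc 0)) (Suc 0) = w" for w
      by (induction w) simp_all
    then show ?thesis
      using t card_mismatch_le[OF x, of K y 1] unfolding I
      by (intro exI[of _ "replicate ?w (False, 1)"] exI[of _ t]) auto
  qed
  then obtain es t where es: "walk base (gray \<circ> snd) (label K x) es t" "snd ` set es \<subseteq> {1..<2 ^ K}"
    and inv: "\<forall>i\<in>{1..<2 ^ K}. even (count_list (map snd es) i + card (mismatch K x y i)) \<and>
      (count_list (map snd es) i = 0 \<longrightarrow> mismatch K x y i = {}) \<and>
      count_list (map snd es) i \<le> card (block K n i)"
    by (elim exE conjE)
  have "\<exists>p. pre_digraph.awalk (with_proj (sparse_cube K n)) x p y \<and>
    length p \<le> (\<Sum>i\<in>{1..<2 ^ K}. max (count_list (map snd es) i) (card (mismatch K x y i)))"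
  proof (rule sparse_cube_walk[OF K x y es(1)])
    show "i \<in> {1..<2 ^ K} \<and> (\<exists>l<n. direction K l = i)" if "i \<in> snd ` set es" for i
      using onto subsetD[OF es(2) that] by blast
    show "even (count_list (map snd es) i + card (mismatch K x y i)) \<and>
      (count_list (map snd es) i = 0 \<longrightarrow> mismatch K x y i = {})" if "i \<in> {1..<2 ^ K}" for i
      using bspec[OF inv that] by blast
  qed
  then obtain p where p: "pre_digraph.awalk (with_proj (sparse_cube K n)) x p y"
    "length p \<le> (\<Sum>i\<in>{1..<2 ^ K}. max (count_list (map snd es) i) (card (mismatch K x y i)))"
    by blast
  note p(2)
  also have "\<dots> \<le> (\<Sum>i\<in>{1..<2 ^ K}. card (block K n i))"
    using inv card_mismatch_le[OF x] by (intro sum_mono) auto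
  also have "\<dots> = n"
    by (rule sum_card_block[OF K])
  finally show ?thesis
    using p(1) by blast
qed

section \<open>Spanning subgraph, degree and diameter\<close>

lemma sparse_cube_subset_hypercube: "parcs (sparse_cube K n) \<subseteq> parcs (hypercube n)"
proof
  fix e
  assume "e \<in> parcs (sparse_cube K n)"
  then obtain x l where "e = (x, flip x l)" "length x = n" "l < n"
    by (auto simp: sparse_cube_def)
  then show "e \<in> parcs (hypercube n)"
    using flip_in_hypercube[of l x] by simp
qed

lemma sparse_cube_arcI:
  "length x = n \<Longrightarrow> l < n \<Longrightarrow> avail (label K x) (direction K l) \<Longrightarrow>
    (x, flip x l) \<in> parcs (sparse_cube K n)"
  by (auto simp: sparse_cube_def)

lemma pair_graph_sparse_cube: "pair_graph (sparse_cube K n)"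
proof -
  interpret H: pair_graph "hypercube n"
    by (rule pair_graph_hypercube)
  note sub = sparse_cube_subset_hypercube[of K n]
  have verts: "pverts (sparse_cube K n) = pverts (hypercube n)"
    by (simp add: sparse_cube_def hypercube_def)
  show ?thesis
  proof
    show "finite (pverts (sparse_cube K n))" "finite (parcs (sparse_cube K n))"
      using H.pair_finite_verts H.pair_finite_arcs finite_subset[OF sub] verts by simp_all
    show "symmetric (with_proj (sparse_cube K n))"
      unfolding symmetric_def with_proj_simps
    proof (rule symI)
      fix x y
      assume "(x, y) \<in> parcs (sparse_cube K n)"
      then obtain l where l: "length x = n" "l < n" "avail (label K x) (direction K l)" "y = flip x l"
        by (auto simp: sparse_cube_def)
      then have "avail (label K (flip x l)) (direction K l)"
        by (simp add: label_flip avail_xor)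
      then have "(flip x l, flip (flip x l) l) \<in> parcs (sparse_cube K n)"
        using l(1,2) by (intro sparse_cube_arcI) simp_all
      then show "(y, x) \<in> parcs (sparse_cube K n)"
        using l(4) by simp
    qed
    fix e
    assume "e \<in> parcs (sparse_cube K n)"
    with sub have "e \<in> parcs (hypercube n)"
      by (rule subsetD)
    then show "fst e \<in> pverts (sparse_cube K n)" "snd e \<in> pverts (sparse_cube K n)" "fst e \<noteq> snd e"
      unfolding verts by (auto intro: H.arc_fst_in_verts H.arc_snd_in_verts dest: H.pair_no_loops)
  qed
qed

lemma spanning_sparse_cube: "spanning (with_proj (sparse_cube K n)) (with_proj (hypercube n))"
proof -
  interpret H: pair_graph "hypercube n"
    by (rule pair_graph_hypercube)
  interpret G: pair_graph "sparse_cube K n"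
    by (rule pair_graph_sparse_cube)
  show ?thesis
    unfolding spanning_def subgraph_def with_proj_simps
    using sparse_cube_subset_hypercube H.wf_digraph_axioms G.wf_digraph_axioms
    by (auto simp: sparse_cube_def hypercube_def)
qed

lemma out_degree_sparse_cube:
  assumes "length x = n"
  shows "out_degree (with_proj (sparse_cube K n)) x \<le> 6 * (n div (2 ^ K - 1) + 1)"
proof -
  let ?A = "{i. avail (label K x) i}"
  have "out_arcs (with_proj (sparse_cube K n)) x \<subseteq> (\<lambda>l. (x, flip x l)) ` (\<Union>i\<in>?A. block K n i)"
    by (auto simp: out_arcs_def sparse_cube_def block_def)
  then have "out_degree (with_proj (sparse_cube K n)) x \<le> card (\<Union>i\<in>?A. block K n i)"
    unfolding out_degree_def using avail_card(1)
    by (intro surj_card_le[of _ _ "\<lambda>l. (x, flip x l)"]) auto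
  also have "\<dots> \<le> (\<Sum>i\<in>?A. card (block K n i))"
    by (rule card_UN_le[OF avail_card(1)])
  also have "\<dots> \<le> (\<Sum>i\<in>?A. n div (2 ^ K - 1) + 1)"
    by (intro sum_mono card_block_le)
  also have "\<dots> \<le> 6 * (n div (2 ^ K - 1) + 1)"
    using avail_card(2)[of "label K x"] by (simp only: sum_constant mult_le_mono1 of_nat_id)
  finally show ?thesis .
qed

text \<open>An arc changes one coordinate, so it removes at most one mismatch. This bounds the
  diameter from below.\<close>

lemma hamming_le_walk_length:
  assumes "pre_digraph.awalk (with_proj (sparse_cube K n)) x p y"
  shows "card {l. l < n \<and> x ! l \<noteq> y ! l} \<le> length p"
  using assms
proof (induction p arbitrary: x)
  case Nil
  then show ?case
    by (simp add: pre_digraph.awalk_def pre_digraph.cas.simps)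
next
  case (Cons e p)
  then have e: "e \<in> parcs (sparse_cube K n)" "fst e = x"
    by (auto simp: pre_digraph.awalk_def pre_digraph.cas.simps)
  then obtain l where l: "e = (x, flip x l)" "length x = n" "l < n"
    by (auto simp: sparse_cube_def)
  then have "pre_digraph.awalk (with_proj (sparse_cube K n)) (flip x l) p y"
    using Cons.prems by (auto simp: pre_digraph.awalk_def pre_digraph.cas.simps sparse_cube_def)
  then have IH: "card {j. j < n \<and> flip x l ! j \<noteq> y ! j} \<le> length p"
    by (rule Cons.IH)
  have "{j. j < n \<and> x ! j \<noteq> y ! j} \<subseteq> insert l {j. j < n \<and> flip x l ! j \<noteq> y ! j}"
    using l by (auto simp: nth_flip)
  then have "card {j. j < n \<and> x ! j \<noteq> y ! j} \<le> card (insert l {j. j < n \<and> flip x l ! j \<noteq> y ! j})"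
    by (intro card_mono) auto
  also have "\<dots> \<le> Suc (card {j. j < n \<and> flip x l ! j \<noteq> y ! j})"
    by (rule card_insert_le_m1) simp_all
  finally show ?case
    using IH by simp
qed

lemma graph_diameter_sparse_cube:
  assumes "K \<ge> 1" "n \<ge> 1" "4 * (2 ^ K - 1) \<le> n \<or> K = 1"
  shows "graph_diameter (with_proj (sparse_cube K n)) = ereal (real n)"
proof -
  interpret pair_graph "sparse_cube K n"
    by (rule pair_graph_sparse_cube)
  let ?G = "with_proj (sparse_cube K n)"
  have V: "verts ?G = {x. length x = n}"
    by (simp add: sparse_cube_def)
  show ?thesis
  proof (rule antisym)
    have "graph_dist ?G x y \<le> ereal (real n)" if xy: "length x = n" "length y = n" for x y
    proof -
      obtain p where "pre_digraph.awalk ?G x p y" "length p \<le> n"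
        using sparse_cube_geodesics[OF assms xy] by blast
      then show ?thesis
        unfolding wf_digraph.graph_dist_eq[OF wf_digraph_axioms]
        by (intro INF_lower2[of p]) simp_all
    qed
    then show "graph_diameter ?G \<le> ereal (real n)"
      unfolding graph_diameter_def V by (intro SUP_least) auto
    \<comment> \<open>Antipodal vertices differ in all \<open>n\<close> coordinates.\<close>
    let ?x = "replicate n False" and ?y = "replicate n True"
    have "ereal (real n) \<le> graph_dist ?G ?x ?y"
      unfolding wf_digraph.graph_dist_eq[OF wf_digraph_axioms]
    proof (rule INF_greatest)
      fix p
      assume "p \<in> {p. pre_digraph.awalk ?G ?x p ?y}"
      then have "card {l. l < n \<and> ?x ! l \<noteq> ?y ! l} \<le> length p"
        by (intro hamming_le_walk_length) simp
      moreover have "{l. l < n \<and> ?x ! l \<noteq> ?y ! l} = {..<n}"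
        by auto
      ultimately show "ereal (real n) \<le> ereal (real (length p))"
        by simp
    qed
    also have "\<dots> \<le> graph_diameter ?G"
      unfolding graph_diameter_def V by (intro SUP_upper2[of "(?x, ?y)"]) simp_all
    finally show "ereal (real n) \<le> graph_diameter ?G" .
  qed
qed

section \<open>Choice of \<open>K\<close> and the final bound\<close>

lemma exists_dimension:
  fixes n :: nat
  shows "\<exists>K\<ge>1. n div (2 ^ K - 1) \<le> 11 \<and> (4 * (2 ^ K - 1) \<le> n \<or> K = 1)"
proof (cases "n < 4")
  case True
  then show ?thesis
    by (intro exI[of _ 1]) simp
next
  case False
  \<comment> \<open>\<open>K\<close> is the least number satisfying \<open>P\<close>: minimality
    puts at least 4 coordinates in each block, and \<open>P K\<close> bounds the blocks from
    above.\<close>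
  define P where "P k \<longleftrightarrow> n < 4 * (2 ^ Suc k - 1)" for k
  have "n < 2 ^ n"
    by (rule less_exp)
  then have "P n"
    unfolding P_def power_Suc by linarith
  then obtain K where K: "P K" "\<And>j. j < K \<Longrightarrow> \<not> P j"
    using exists_least_iff[of P] by blast
  have "\<not> P 0 \<Longrightarrow> K \<noteq> 0"
    using K(1) by metis
  then have pos: "K \<ge> 1"
    using False by (simp add: P_def Suc_le_eq)
  then have ge: "4 * (2 ^ K - 1) \<le> n"
    using K(2)[of "K - 1"] by (simp add: P_def not_less)
  have "(2::nat) ^ 1 \<le> 2 ^ K"
    using pos by (intro power_increasing) auto
  then have m: "1 \<le> (2::nat) ^ K - 1"
    by simp
  have "n < 8 * 2 ^ K - 4"
    using K(1) by (simp add: P_def)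
  \<comment> \<open>This amounts to \<open>8 \<le> 4 * 2 ^ K\<close>, hence to
    \<open>K \<ge> 1\<close>.\<close>
  also have "\<dots> \<le> 12 * (2 ^ K - 1)"
    using m by simp
  finally have "n div (2 ^ K - 1) < 12"
    using m by (simp add: div_less_iff_less_mult)
  then show ?thesis
    using pos ge by (intro exI[of _ K]) simp
qed

theorem theorem1p2:
  fixes n :: nat
  assumes "n \<ge> 1"
  shows "\<exists>G :: bool list pair_pre_digraph.
    pair_graph G \<and> spanning (with_proj G) (with_proj (hypercube n)) \<and>
    max_degree (with_proj G) \<le> 120 \<and>
    graph_diameter (with_proj G) = ereal (real n)"
proof -
  obtain K where K: "K \<ge> 1" "n div (2 ^ K - 1) \<le> 11" "4 * (2 ^ K - 1) \<le> n \<or> K = 1"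
    using exists_dimension by blast
  let ?G = "sparse_cube K n"
  interpret pair_graph ?G
    by (rule pair_graph_sparse_cube)
  \<comment> \<open>The degree is at most \<open>6 * (11 + 1) = 72\<close>.\<close>
  have "out_degree (with_proj ?G) x \<le> 120" if "x \<in> verts (with_proj ?G)" for x
    using out_degree_sparse_cube[of x n K] that K(2) by (simp add: sparse_cube_def)
  moreover have "verts (with_proj ?G) \<noteq> {}" "finite (verts (with_proj ?G))"
    using pair_finite_verts length_replicate[of n True] by (auto simp: sparse_cube_def simp del: length_replicate)
  ultimately have "max_degree (with_proj ?G) \<le> 120"
    unfolding max_degree_def by (subst Max_le_iff) auto
  then show ?thesis
    using pair_graph_sparse_cube spanning_sparse_cube graph_diameter_sparse_cube[OF K(1) assms K(3)]
    by blast
qed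

end
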